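(* Let $F(x)=\sum_{n=0}^\infty a_nx^n$ be the generating function of the Franel numbers $a_n=\sum_{k=0}^n\binom nk^3$, $n\ge0$. Then $F$, which is defined on the disk $|x|<1/8$, satisfies the functional equations $$F\left(\frac{t(t+6)}{8(t+3)^2}\right)=2\left[\frac{t+3}{t+6}\right]F\left(\frac{t^2}{8(t+3)(t+6)}\right),$$ $$F\left(\frac{t(t^2+6t+12)}{8(t+3)(t^2+3t+3)}\right)=3\left[\frac{t^2+3t+3}{(t+3)^2}\right]F\left(\frac{t^3}{8(t+3)^3}\right),$$ for all complex $t$ with $|t|$ sufficiently small, and also for all real $t>0$. *)

theory Defs
  imports "HOL-Analysis.Analysis"
begin

definition franel :: "nat \<Rightarrow> nat" where
  "franel n = (\<Sum>k=0..n. (n choose k) ^ 3)"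

(* Meaningful only where the series converges: suminf is unspecified elsewhere. *)
definition franel_gf :: "complex \<Rightarrow> complex" where
  "franel_gf x = (\<Sum>n. of_nat (franel n) * x ^ n)"

end

theory Submission
  imports Defs "HOL-Complex_Analysis.Complex_Analysis"
begin

text \<open>
  The generating function \<open>F\<close> solves \<open>(p F')' = (2 + 8x) F\<close> with \<open>p(x) = x (1 + x) (1 - 8x)\<close>. Write either
  identity as \<open>F(x(t)) = c(t) F(y(t))\<close> and put \<open>P = p(x) / x'\<close>. Then \<open>F(x(t))\<close> solves the pulled-back
  equation \<open>(P G')' = x' (2 + 8x) G\<close>, and two rational identities show that so does \<open>c(t) F(y(t))\<close>.
  As \<open>P\<close> has a simple zero at \<open>0\<close>, the only holomorphic solution vanishing at \<open>0\<close> is zero: for a solution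
  \<open>t^m g\<close> with \<open>g(0) \<noteq> 0\<close> the lowest-order coefficient gives \<open>m^2 P'(0) g(0) = 0\<close>. Hence both sides agree
  on every domain containing \<open>0\<close> on which \<open>x\<close> and \<open>y\<close> stay in the disk of convergence, and some such
  domain contains the half-line \<open>t \<ge> 0\<close>.
\<close>

section \<open>The Franel recurrence\<close>

text \<open>Terms with \<open>k > n\<close> vanish, so \<open>franel n\<close>,
  \<open>franel (n + 1)\<close> and \<open>franel (n + 2)\<close> can all be summed over the same
  range \<open>k < n + 3\<close>.\<close>

lemma franel_eq_sum_lessThan:
  assumes "n < m"
  shows "franel n = (\<Sum>k<m. (n choose k) ^ 3)"
  unfolding franel_def atLeast0AtMost
  by (rule sum.mono_neutral_left) (use assms in auto)

text \<open>
  Zeilberger's certificate \<open>q\<close> for the summand \<open>(n choose k)^3\<close>. All binomial coefficients are expressed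
  through \<open>W = ((n + 2) choose k) / (n + 2)\<close>, with \<open>W'\<close> the same quantity at \<open>k + 1\<close>, so that no
  denominator vanishes on the range of summation.
\<close>

lemma franel_telescoping:
  fixes N K W W' :: real
  assumes "N + 1 \<noteq> 0" and W': "(K + 1) * W' = (N + 2 - K) * W"
  defines "q \<equiv> \<lambda>k. 4 * k^3 - (18 * N + 30) * k^2 + (27 * N^2 + 93 * N + 78) * k
              - (14 * N^3 + 74 * N^2 + 128 * N + 72)"
  shows "(N + 2)^2 * ((N + 2) * W)^3
       - (7 * (N + 1)^2 + 7 * (N + 1) + 2) * ((N + 2 - K) * W)^3
       - 8 * (N + 1)^2 * ((N + 1 - K) * ((N + 2 - K) * W) / (N + 1))^3
     = q (K + 1) * ((K + 1) * W')^3 / (N + 1) - q K * (K * W)^3 / (N + 1)" (is "?L = ?R")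
proof -
  have "8 * (N + 1)^2 * (Z / (N + 1))^3 = 8 * Z^3 / (N + 1)" for Z
    using assms(1) by (simp add: power_divide power2_eq_square power3_eq_cube divide_simps)
  then have L: "?L * (N + 1) = ((N + 2)^2 * ((N + 2) * W)^3
       - (7 * (N + 1)^2 + 7 * (N + 1) + 2) * ((N + 2 - K) * W)^3) * (N + 1)
       - 8 * ((N + 1 - K) * ((N + 2 - K) * W))^3"
    using assms(1) by (simp add: left_diff_distrib)
  have R: "?R * (N + 1) = q (K + 1) * ((N + 2 - K) * W)^3 - q K * (K * W)^3"
    using assms(1) by (simp add: W' left_diff_distrib)
  \<comment> \<open>With the denominator cleared and \<open>W'\<close> eliminated through its
    recurrence, a polynomial identity in \<open>N\<close>, \<open>K\<close> and \<open>W\<close>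
    remains.\<close>
  have "?L * (N + 1) = ?R * (N + 1)"
    unfolding L R unfolding q_def by algebra
  then show ?thesis
    using assms(1) by simp
qed

text \<open>Creative telescoping: the recurrence operator applied to the summand is a difference
  \<open>G (k + 1) - G k\<close>, so summing over \<open>k\<close> leaves only two boundary
  values.\<close>

lemma franel_recurrence:
  "(real n + 2)^2 * real (franel (n + 2))
     = (7 * (real n + 1)^2 + 7 * (real n + 1) + 2) * real (franel (n + 1))
       + 8 * (real n + 1)^2 * real (franel n)"
proof -
  define w where "w k = real ((n + 2) choose k) / (real n + 2)" for k
  define q where "q k = 4 * k^3 - (18 * real n + 30) * k^2 + (27 * real n^2 + 93 * real n + 78) * k
              - (14 * real n^3 + 74 * real n^2 + 128 * real n + 72)" for k
  define G where "G k = q (real k) * (real k * w k)^3 / (real n + 1)" for k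
  have b2: "real ((n + 2) choose k) = (real n + 2) * w k" for k
    by (simp add: w_def)
  have b1: "real ((n + 1) choose k) = (real n + 2 - real k) * w k" if "k \<le> n + 2" for k
  proof -
    have "real ((n + 2 - k) * ((n + 2) choose k)) = real ((n + 2) * ((n + 1) choose k))"
      using binomial_absorb_comp[of "n + 2" k] by simp
    then show ?thesis
      using that by (simp add: w_def of_nat_diff field_simps)
  qed
  have b0: "real (n choose k) = (real n + 1 - real k) * ((real n + 2 - real k) * w k) / (real n + 1)"
    if "k \<le> n + 2" for k
  \<comment> \<open>At \<open>k = n + 2\<close> the natural number \<open>n + 1 - k\<close> would be
    truncated. There both sides are 0, the right one through the factor
    \<open>n + 2 - k\<close>.\<close>
  proof (cases "k = n + 2")
    case False
    have "real ((n + 1 - k) * ((n + 1) choose k)) = real ((n + 1) * (n choose k))"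
      using binomial_absorb_comp[of "n + 1" k] by simp
    then have "real (n choose k) = (real n + 1 - real k) * real ((n + 1) choose k) / (real n + 1)"
      using that False by (simp add: of_nat_diff field_simps)
    then show ?thesis
      by (simp only: b1[OF that])
  qed simp
  have step: "(real k + 1) * w (Suc k) = (real n + 2 - real k) * w k" if "k \<le> n + 2" for k
  proof -
    have "real (Suc k * ((n + 2) choose Suc k)) = real ((n + 2) * ((n + 1) choose k))"
      using Suc_times_binomial[of k "n + 1"] by (simp only: add_2_eq_Suc' Suc_eq_plus1 [symmetric])
    then show ?thesis
      using b1[OF that] by (simp add: w_def field_simps)
  qed
  have "(real n + 2)^2 * real ((n + 2) choose k) ^ 3
      - (7 * (real n + 1)^2 + 7 * (real n + 1) + 2) * real ((n + 1) choose k) ^ 3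
      - 8 * (real n + 1)^2 * real (n choose k) ^ 3 = G (Suc k) - G k" if "k < n + 3" for k
  proof -
    have k: "k \<le> n + 2"
      using that by simp
    show ?thesis
      unfolding b2 b1[OF k] b0[OF k] G_def q_def
      using franel_telescoping[OF _ step[OF k]] by (simp add: add.commute)
  qed
  then have "(\<Sum>k<n + 3. (real n + 2)^2 * real ((n + 2) choose k) ^ 3
      - (7 * (real n + 1)^2 + 7 * (real n + 1) + 2) * real ((n + 1) choose k) ^ 3
      - 8 * (real n + 1)^2 * real (n choose k) ^ 3) = (\<Sum>k<n + 3. G (Suc k) - G k)"
    by (intro sum.cong) auto
  \<comment> \<open>\<open>G 0\<close> contains the factor \<open>k = 0\<close>, and
    \<open>G (n + 3)\<close> contains \<open>(n + 2) choose (n + 3) = 0\<close>.\<close>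
  also have "\<dots> = 0"
    by (subst sum_lessThan_telescope) (simp add: G_def w_def)
  moreover have "real (franel m) = (\<Sum>k<n + 3. real (m choose k) ^ 3)" if "m \<le> n + 2" for m
    using that by (subst franel_eq_sum_lessThan[of m "n + 3"]) simp_all
  ultimately show ?thesis
    by (simp add: sum_subtractf sum_distrib_left [symmetric])
qed

section \<open>The differential equation of the generating function\<close>

text \<open>Two of the three binomial factors are bounded by \<open>2 ^ n\<close> each, and the
  third sums to \<open>2 ^ n\<close> over the row. This bound yields the radius 1/8.\<close>

lemma franel_le: "franel n \<le> 8 ^ n"
proof -
  have "franel n \<le> (\<Sum>k\<le>n. (2 ^ n)^2 * (n choose k))"
    unfolding franel_def atLeast0AtMost
  proof (rule sum_mono)
    fix k
    have "(n choose k)^2 \<le> (2 ^ n)^2"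
      by (rule power_mono) (auto simp: binomial_le_pow2)
    then show "(n choose k)^3 \<le> (2 ^ n)^2 * (n choose k)"
      by (simp add: power3_eq_cube power2_eq_square)
  qed
  also have "\<dots> = (2 ^ n)^2 * 2 ^ n"
    by (simp add: sum_distrib_left [symmetric] choose_row_sum)
  also have "\<dots> = 8 ^ n"
    by (simp flip: power_mult_distrib add: power2_eq_square)
  finally show ?thesis .
qed

lemma summable_franel:
  fixes x :: complex
  assumes "norm x < 1/8"
  shows "summable (\<lambda>n. of_nat (franel n) * x ^ n)"
proof (rule summable_comparison_test')
  show "summable (\<lambda>n. (8 * norm x) ^ n)"
    using assms by (intro summable_geometric) auto
  show "norm (of_nat (franel n) * x ^ n) \<le> (8 * norm x) ^ n" for n
    using of_nat_mono[OF franel_le[of n], where 'a=real]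
    by (simp add: norm_mult norm_power power_mult_distrib mult_right_mono)
qed

definition franel_fps :: "complex fps" where
  "franel_fps = Abs_fps (\<lambda>n. of_nat (franel n))"

lemma eval_franel_fps: "eval_fps franel_fps = franel_gf"
  by (simp add: fun_eq_iff eval_fps_def franel_gf_def franel_fps_def)

lemma fps_conv_radius_franel: "fps_conv_radius franel_fps \<ge> ereal (1/8)"
  unfolding fps_conv_radius_def
proof (rule conv_radius_geI_ex)
  fix r :: real
  assume "0 < r" "ereal r < ereal (1/8)"
  then show "\<exists>z. norm z = r \<and> summable (\<lambda>n. fps_nth franel_fps n * z ^ n)"
    by (intro exI[of _ "of_real r"]) (auto intro: summable_franel simp: franel_fps_def)
qed

text \<open>Comparing coefficients at index \<open>n = m + 1\<close> gives the Franel recurrence at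
  \<open>m\<close>; at index 0 it says that the second Franel number is twice the first. The cubic
  polynomial is x (1 + x) (1 - 8x).\<close>

lemma franel_fps_ode:
  "fps_deriv (fps_of_poly [:0, 1, -7, -8:] * fps_deriv franel_fps) = fps_of_poly [:2, 8:] * franel_fps"
proof (rule fps_ext)
  fix n
  have rec: "(of_nat n + 2)^2 * of_nat (franel (n + 2))
     = (7 * (of_nat n + 1)^2 + 7 * (of_nat n + 1) + 2) * of_nat (franel (n + 1))
       + 8 * (of_nat n + 1)^2 * (of_nat (franel n) :: complex)" for n
    using arg_cong[OF franel_recurrence[of n], of complex_of_real] by simp
  have pCons_mult: "fps_of_poly (pCons a p) * G = fps_const a * G + fps_of_poly p * (fps_X * G)"
    for a :: complex and p G
    by (simp add: fps_of_poly_pCons algebra_simps)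
  show "fps_nth (fps_deriv (fps_of_poly [:0, 1, -7, -8:] * fps_deriv franel_fps)) n
      = fps_nth (fps_of_poly [:2, 8:] * franel_fps) n"
  proof (cases n)
    case 0
    then show ?thesis
      unfolding pCons_mult by (simp add: franel_fps_def franel_def)
  next
    case (Suc m)
    then show ?thesis
      using rec[of m] unfolding pCons_mult
      \<comment> \<open>The term x^3 F' contributes the coefficient of F' at \<open>m - 1\<close>,
        which is absent for \<open>m = 0\<close>.\<close>
      by (cases m) (auto simp: franel_fps_def power2_eq_square algebra_simps)
  qed
qed

text \<open>In this self-adjoint form the equation gives a derivative of p F' as a whole, so it can
  be pulled back by the chain rule without second derivatives.\<close>

lemma franel_gf_ode:
  obtains F' :: "complex \<Rightarrow> complex"
  where "\<And>x. norm x < 1/8 \<Longrightarrow> (franel_gf has_field_derivative F' x) (at x)"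
    and "\<And>x. norm x < 1/8 \<Longrightarrow>
      ((\<lambda>x. (x - 7 * x^2 - 8 * x^3) * F' x) has_field_derivative (2 + 8 * x) * franel_gf x) (at x)"
proof
  let ?F' = "eval_fps (fps_deriv franel_fps)"
  let ?G = "fps_of_poly [:0, 1, -7, -8:] * fps_deriv franel_fps"
  have rad: "ereal (norm x) < fps_conv_radius franel_fps"
    if "norm x < 1/8" for x :: complex
    using that less_le_trans[OF _ fps_conv_radius_franel, of "ereal (norm x)"] by simp
  have rad': "ereal (norm x) < fps_conv_radius (fps_deriv franel_fps)"
    if "norm x < 1/8" for x :: complex
    using rad[OF that] fps_conv_radius_deriv by (rule less_le_trans)
  have rad'': "ereal (norm x) < fps_conv_radius ?G" if "norm x < 1/8" for x :: complex
    using less_le_trans[OF _ fps_conv_radius_mult[of "fps_of_poly [:0, 1, -7, -8:]" "fps_deriv franel_fps"]]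
      rad'[OF that] by simp
  show "(franel_gf has_field_derivative ?F' x) (at x)" if "norm x < 1/8" for x
    using has_field_derivative_eval_fps[OF rad[OF that]] by (simp add: eval_franel_fps)
  show "((\<lambda>x. (x - 7 * x^2 - 8 * x^3) * ?F' x) has_field_derivative (2 + 8 * x) * franel_gf x) (at x)"
    if x: "norm x < 1/8" for x
  proof -
    have "(eval_fps ?G has_field_derivative eval_fps (fps_of_poly [:2, 8:] * franel_fps) x) (at x)"
      using has_field_derivative_eval_fps[OF rad''[OF x]] by (simp only: franel_fps_ode)
    also have "eval_fps (fps_of_poly [:2, 8:] * franel_fps) x = (2 + 8 * x) * franel_gf x"
      using rad[OF x] by (simp add: eval_fps_mult eval_franel_fps mult.commute)
    finally show ?thesis
    \<comment> \<open>Evaluation is multiplicative only where the factors converge, so the two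
      functions are identified on the disk rather than globally.\<close>
    proof (rule has_field_derivative_transform_within_open)
      show "open (ball (0::complex) (1/8))" "x \<in> ball 0 (1/8)"
        using x by auto
      show "eval_fps ?G z = (z - 7 * z^2 - 8 * z^3) * ?F' z" if "z \<in> ball 0 (1/8)" for z
        using that rad'[of z]
        by (simp add: eval_fps_mult power2_eq_square power3_eq_cube algebra_simps)
    qed
  qed
qed

section \<open>Uniqueness at a regular singular point\<close>

text \<open>Both exponents at 0 are zero and holomorphy excludes the logarithmic solution. Hence the
  single initial value \<open>D 0 = 0\<close> suffices, where a regular point would also need the
  derivative.\<close>

lemma regular_singular_unique:
  fixes D D' p V :: "complex \<Rightarrow> complex"
  assumes S: "open S" "connected S" "0 \<in> S"
    and D: "\<And>t. t \<in> S \<Longrightarrow> (D has_field_derivative D' t) (at t)" "D 0 = 0"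
    and p: "p holomorphic_on S" "p 0 \<noteq> 0"
    and V: "V holomorphic_on S"
    and ode: "\<And>t. t \<in> S \<Longrightarrow>
      ((\<lambda>t. t * p t * D' t) has_field_derivative V t * D t) (at t)"
    and "t \<in> S"
  shows "D t = 0"
proof -
  have hol: "D holomorphic_on S"
    using D(1) S(1) by (auto simp: holomorphic_on_open)
  \<comment> \<open>A nonconstant \<open>D\<close> has a zero of finite order at 0; a constant one
    is zero because \<open>D 0 = 0\<close>.\<close>
  have "D constant_on S"
  proof (rule ccontr)
    assume "\<not> D constant_on S"
    then obtain g r m where m: "0 < m" and r: "0 < r" "ball 0 r \<subseteq> S"
      and g: "g holomorphic_on ball 0 r"
      and Dg: "\<And>w. w \<in> ball 0 r \<Longrightarrow> D w = w ^ m * g w"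
      and g0: "\<And>w. w \<in> ball 0 r \<Longrightarrow> g w \<noteq> 0"
      using holomorphic_factor_zero_nonconstant[OF hol S(1,2,3) D(2)] by (metis diff_zero)
    let ?B = "ball (0::complex) r"
    obtain k where k: "m = Suc k"
      using m by (cases m) auto
    \<comment> \<open>Chosen so that \<open>t * p t * D' t = t ^ m * h t\<close>: the flux vanishes
      at 0 to at least the same order as \<open>D\<close>.\<close>
    define h where "h t = p t * (of_nat m * g t + t * deriv g t)" for t
    have h: "h holomorphic_on ?B"
      unfolding h_def using r(2) p(1) g
      by (intro holomorphic_intros holomorphic_deriv) (auto intro: holomorphic_on_subset)
    have deriv_power_mult: "((\<lambda>t. t ^ m * f t) has_field_derivative
        t ^ m * f' + of_nat m * t ^ k * f t) (at t)"
      if "(f has_field_derivative f') (at t)" for f f' and t :: complex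
      using DERIV_mult'[OF DERIV_power[OF DERIV_ident] that, of m] by (simp add: k)
    have g': "(g has_field_derivative deriv g t) (at t)" if "t \<in> ?B" for t
      using holomorphic_derivI[OF g _ that] by simp
    have h': "(h has_field_derivative deriv h t) (at t)" if "t \<in> ?B" for t
      using holomorphic_derivI[OF h _ that] by simp
    have D'eq: "t * p t * D' t = t ^ m * h t" if t: "t \<in> ?B" for t
    proof -
      have "((\<lambda>t. t ^ m * g t) has_field_derivative D' t) (at t)"
        using D(1)[of t] r(2) t Dg
        by (intro has_field_derivative_transform_within_open[OF D(1)[of t], of ?B]) auto
      moreover have "((\<lambda>t. t ^ m * g t) has_field_derivative
          t ^ m * deriv g t + of_nat m * t ^ k * g t) (at t)"
        by (rule deriv_power_mult[OF g'[OF t]])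
      ultimately have "D' t = t ^ m * deriv g t + of_nat m * t ^ k * g t"
        by (rule DERIV_unique)
      then show ?thesis
        by (simp add: h_def k algebra_simps)
    qed
    have zero: "of_nat m * h t + t * deriv h t - t * V t * g t = 0" if t: "t \<in> ?B" "t \<noteq> 0" for t
    proof -
      have "((\<lambda>t. t ^ m * h t) has_field_derivative V t * D t) (at t)"
        using r(2) t D'eq
        by (intro has_field_derivative_transform_within_open[OF ode[of t], of ?B]) auto
      moreover have "((\<lambda>t. t ^ m * h t) has_field_derivative
          t ^ m * deriv h t + of_nat m * t ^ k * h t) (at t)"
        by (rule deriv_power_mult[OF h'[OF t(1)]])
      ultimately have "V t * D t = t ^ m * deriv h t + of_nat m * t ^ k * h t"
        by (rule DERIV_unique)
      then have "t ^ k * (of_nat m * h t + t * deriv h t - t * V t * g t) = 0"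
        using Dg[OF t(1)] by (simp add: k algebra_simps)
      then show ?thesis
        using t(2) by simp
    qed
    \<comment> \<open>The relation was obtained by cancelling \<open>t ^ k\<close>, hence only for
      \<open>t \<noteq> 0\<close>. Continuity carries it to 0, where it reads m^2 p(0) g(0) =
      0.\<close>
    have "(\<lambda>t. of_nat m * h t + t * deriv h t - t * V t * g t) holomorphic_on ?B"
      using h g V r(2)
      by (intro holomorphic_intros holomorphic_deriv) (auto intro: holomorphic_on_subset)
    then have "continuous_on ?B (\<lambda>t. of_nat m * h t + t * deriv h t - t * V t * g t)"
      by (rule holomorphic_on_imp_continuous_on)
    then have "isCont (\<lambda>t. of_nat m * h t + t * deriv h t - t * V t * g t) 0"
      using r(1) by (simp add: continuous_on_eq_continuous_at)
    then have "(\<lambda>t. of_nat m * h t + t * deriv h t - t * V t * g t) \<midarrow>0\<rightarrow> of_nat m * h 0"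
      by (simp add: isCont_def)
    moreover have "(\<lambda>t. of_nat m * h t + t * deriv h t - t * V t * g t) \<midarrow>0\<rightarrow> 0"
      by (rule Lim_transform_within_open[where s = ?B, OF tendsto_const]) (use r(1) zero in auto)
    ultimately have "of_nat m * h 0 = 0"
      by (rule LIM_unique)
    then show False
      using m p(2) g0[of 0] r(1) by (simp add: h_def)
  qed
  then show ?thesis
    using D(2) S(3) \<open>t \<in> S\<close> by (metis constant_on_def)
qed

section \<open>Transformations of the generating function\<close>

text \<open>
  In contrast to the introduction, \<open>p\<close> is here the cofactor in \<open>P(t) = t p(t)\<close>. The assumption \<open>py\<close>, with a constant \<open>l\<close>, says that the two sides have
  proportional Wronskians and matches the first-order terms of their equations; \<open>eq\<close> matches the
  terms of order zero.
\<close>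

lemma franel_gf_transformation_connected:
  fixes x y c x' y' c' p W :: "complex \<Rightarrow> complex" and l :: complex
  assumes S: "open S" "connected S" "0 \<in> S"
    and xS: "\<And>t. t \<in> S \<Longrightarrow> norm (x t) < 1/8" and yS: "\<And>t. t \<in> S \<Longrightarrow> norm (y t) < 1/8"
    and x: "\<And>t. t \<in> S \<Longrightarrow> (x has_field_derivative x' t) (at t)"
    and y: "\<And>t. t \<in> S \<Longrightarrow> (y has_field_derivative y' t) (at t)"
    and c: "\<And>t. t \<in> S \<Longrightarrow> (c has_field_derivative c' t) (at t)"
    and c0: "\<And>t. t \<in> S \<Longrightarrow> c t \<noteq> 0"
    and init: "x 0 = 0" "y 0 = 0" "c 0 = 1"
    and p: "p holomorphic_on S" "p 0 \<noteq> 0"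
    and px: "\<And>t. t \<in> S \<Longrightarrow> t * p t * x' t = x t - 7 * x t^2 - 8 * x t^3"
    and py: "\<And>t. t \<in> S \<Longrightarrow> t * p t * y' t * c t^2 = l * (y t - 7 * y t^2 - 8 * y t^3)"
    and W: "\<And>t. t \<in> S \<Longrightarrow> ((\<lambda>t. t * p t * c' t) has_field_derivative W t) (at t)"
    and eq: "\<And>t. t \<in> S \<Longrightarrow> W t * c t + l * y' t * (2 + 8 * y t) = x' t * (2 + 8 * x t) * c t^2"
    and "t \<in> S"
  shows "franel_gf (x t) = c t * franel_gf (y t)"
proof -
  obtain F' where F: "\<And>x. norm x < 1/8 \<Longrightarrow> (franel_gf has_field_derivative F' x) (at x)"
    and ode: "\<And>x. norm x < 1/8 \<Longrightarrow>
      ((\<lambda>x. (x - 7 * x^2 - 8 * x^3) * F' x) has_field_derivative (2 + 8 * x) * franel_gf x) (at x)"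
    using franel_gf_ode by blast
  define D where "D t = franel_gf (x t) - c t * franel_gf (y t)" for t
  define D' where "D' t = F' (x t) * x' t - (c' t * franel_gf (y t) + c t * (F' (y t) * y' t))" for t
  define V where "V t = x' t * (2 + 8 * x t)" for t
  have Fx: "((\<lambda>t. franel_gf (x t)) has_field_derivative F' (x t) * x' t) (at t)" if "t \<in> S" for t
    using DERIV_chain2[OF F[OF xS[OF that]] x[OF that]] .
  have Fy: "((\<lambda>t. franel_gf (y t)) has_field_derivative F' (y t) * y' t) (at t)" if "t \<in> S" for t
    using DERIV_chain2[OF F[OF yS[OF that]] y[OF that]] .
  have "D t = 0"
  proof (rule regular_singular_unique[OF S _ _ p _ _ \<open>t \<in> S\<close>])
    show "(D has_field_derivative D' t) (at t)" if "t \<in> S" for t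
      unfolding D_def D'_def using Fx[OF that] Fy[OF that] c[OF that]
      by (auto intro!: derivative_eq_intros)
    show "D 0 = 0"
      by (simp add: D_def init)
    have "x holomorphic_on S"
      using x S(1) by (auto simp: holomorphic_on_open)
    moreover have "x' holomorphic_on S"
      by (rule holomorphic_transform[OF holomorphic_deriv[OF \<open>x holomorphic_on S\<close> S(1)]])
        (use x in \<open>auto intro: DERIV_imp_deriv\<close>)
    ultimately show "V holomorphic_on S"
      unfolding V_def by (intro holomorphic_intros)
    show "((\<lambda>t. t * p t * D' t) has_field_derivative V t * D t) (at t)" if t: "t \<in> S" for t
    proof -
      let ?q = "\<lambda>x. (x - 7 * x^2 - 8 * x^3) * F' x"
      \<comment> \<open>\<open>?E\<close> is \<open>t * p t * D' t\<close> regrouped by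
        \<open>px\<close> and \<open>py\<close> so that \<open>F'\<close> occurs only inside
        \<open>?q\<close>, whose derivative the differential equation supplies.\<close>
      let ?E = "\<lambda>t. ?q (x t) - (t * p t * c' t * franel_gf (y t) + l * ?q (y t) / c t)"
      have qy: "l * ?q (y t) = t * p t * y' t * c t^2 * F' (y t)" if "t \<in> S" for t
        using py[OF that] by simp
      have E: "?E t = t * p t * D' t" if "t \<in> S" for t
      proof -
        have "l * ?q (y t) / c t = t * p t * y' t * c t * F' (y t)"
          using c0[OF that] by (subst qy[OF that]) (simp add: power2_eq_square)
        moreover have "?q (x t) = t * p t * x' t * F' (x t)"
          using px[OF that] by simp
        ultimately show ?thesis
          by (simp only: D'_def) (simp add: algebra_simps)
      qed
      have "(?E has_field_derivative V t * D t) (at t)"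
      proof -
        have qx: "((\<lambda>t. ?q (x t)) has_field_derivative (2 + 8 * x t) * franel_gf (x t) * x' t) (at t)"
          using DERIV_chain2[OF ode[OF xS[OF t]] x[OF t]] .
        have q_y: "((\<lambda>t. ?q (y t)) has_field_derivative (2 + 8 * y t) * franel_gf (y t) * y' t) (at t)"
          using DERIV_chain2[OF ode[OF yS[OF t]] y[OF t]] .
        have "(?E has_field_derivative
            (2 + 8 * x t) * franel_gf (x t) * x' t
            - (t * p t * c' t * (F' (y t) * y' t) + W t * franel_gf (y t)
              + (l * ((2 + 8 * y t) * franel_gf (y t) * y' t) * c t - l * ?q (y t) * c' t)
                / (c t * c t))) (at t)"
          using c0[OF t]
          by (intro DERIV_diff DERIV_add DERIV_mult' DERIV_divide DERIV_cmult qx q_y Fy[OF t] W[OF t] c[OF t])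
        \<comment> \<open>The two terms with \<open>F' (y t)\<close> cancel by \<open>py\<close>
          (fact 1), and \<open>eq\<close> turns the coefficient of \<open>franel_gf (y t)\<close>
          into \<open>V t * c t\<close> (fact 2).\<close>
        moreover have "t * p t * c' t * (F' (y t) * y' t) + W t * franel_gf (y t)
              + (l * ((2 + 8 * y t) * franel_gf (y t) * y' t) * c t - l * ?q (y t) * c' t)
                / (c t * c t) = V t * c t * franel_gf (y t)"
        proof -
          have 1: "l * ?q (y t) * c' t / (c t * c t) = t * p t * c' t * (F' (y t) * y' t)"
            using c0[OF t] by (subst qy[OF t]) (simp add: power2_eq_square)
          have 2: "W t + l * (2 + 8 * y t) * y' t / c t = V t * c t"
            using eq[OF t] c0[OF t] by (simp add: V_def field_simps power2_eq_square)
          have "l * ((2 + 8 * y t) * franel_gf (y t) * y' t) * c t / (c t * c t)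
              = (V t * c t - W t) * franel_gf (y t)"
            unfolding 2[symmetric] using c0[OF t] by (simp add: field_simps)
          then show ?thesis
            by (simp only: diff_divide_distrib 1) (simp add: algebra_simps)
        qed
        ultimately show ?thesis
          by (simp add: D_def V_def algebra_simps)
      qed
      then show ?thesis
        by (rule has_field_derivative_transform_within_open[OF _ S(1) t]) (rule E)
    qed
  qed
  then show ?thesis
    by (simp add: D_def)
qed

text \<open>\<open>S\<close> is the component of 0 in the open set where both bounds hold. The
  half-line is a connected subset of that set through 0, so it lies in this component.\<close>

lemma connected_domain_obtain:
  fixes x y :: "complex \<Rightarrow> complex"
  assumes T: "open T" "continuous_on T x" "continuous_on T y"
    and pos: "\<And>r::real. r \<ge> 0 \<Longrightarrow> of_real r \<in> T"
             "\<And>r::real. r \<ge> 0 \<Longrightarrow> norm (x (of_real r)) < d"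
             "\<And>r::real. r \<ge> 0 \<Longrightarrow> norm (y (of_real r)) < d"
  obtains S where "open S" "connected S" "S \<subseteq> T" "\<And>r::real. r \<ge> 0 \<Longrightarrow> of_real r \<in> S"
    "\<And>t. t \<in> S \<Longrightarrow> norm (x t) < d" "\<And>t. t \<in> S \<Longrightarrow> norm (y t) < d"
proof -
  define U where "U = (T \<inter> x -` ball 0 d) \<inter> (T \<inter> y -` ball 0 d)"
  have "open U"
    unfolding U_def by (intro open_Int continuous_open_preimage T open_ball)
  have "connected (complex_of_real ` {0..})"
    by (intro connected_continuous_image continuous_intros) auto
  moreover have "complex_of_real ` {0..} \<subseteq> U"
    using pos by (auto simp: U_def)
  ultimately have "complex_of_real ` {0..} \<subseteq> connected_component_set U 0"
    by (intro connected_component_maximal) auto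
  show ?thesis
  proof (rule that[of "connected_component_set U 0"])
    show "open (connected_component_set U 0)"
      using \<open>open U\<close> by (rule open_connected_component)
    show "connected (connected_component_set U 0)"
      by (rule connected_connected_component)
    have "connected_component_set U 0 \<subseteq> U"
      by (rule connected_component_subset)
    then show "connected_component_set U 0 \<subseteq> T"
      "\<And>t. t \<in> connected_component_set U 0 \<Longrightarrow> norm (x t) < d"
      "\<And>t. t \<in> connected_component_set U 0 \<Longrightarrow> norm (y t) < d"
      by (auto simp: U_def)
    show "of_real r \<in> connected_component_set U 0" if "r \<ge> 0" for r
      using \<open>complex_of_real ` {0..} \<subseteq> connected_component_set U 0\<close> that by auto
  qed
qed

text \<open>The bounds on \<open>x\<close> and \<open>y\<close> are checked on the half-line and
  extend by continuity to a connected open \<open>S\<close> around it. A ball about 0 inside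
  \<open>S\<close> covers the small complex \<open>t\<close>.\<close>

lemma franel_gf_transformation:
  fixes x y c x' y' c' p W :: "complex \<Rightarrow> complex" and l :: complex
  assumes T: "open T"
    and pos: "\<And>r::real. r \<ge> 0 \<Longrightarrow> of_real r \<in> T"
             "\<And>r::real. r \<ge> 0 \<Longrightarrow> norm (x (of_real r)) < 1/8"
             "\<And>r::real. r \<ge> 0 \<Longrightarrow> norm (y (of_real r)) < 1/8"
    and x: "\<And>t. t \<in> T \<Longrightarrow> (x has_field_derivative x' t) (at t)"
    and y: "\<And>t. t \<in> T \<Longrightarrow> (y has_field_derivative y' t) (at t)"
    and c: "\<And>t. t \<in> T \<Longrightarrow> (c has_field_derivative c' t) (at t)"
    and c0: "\<And>t. t \<in> T \<Longrightarrow> c t \<noteq> 0"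
    and init: "x 0 = 0" "y 0 = 0" "c 0 = 1"
    and p: "p holomorphic_on T" "p 0 \<noteq> 0"
    and px: "\<And>t. t \<in> T \<Longrightarrow> t * p t * x' t = x t * (1 + x t) * (1 - 8 * x t)"
    and py: "\<And>t. t \<in> T \<Longrightarrow> t * p t * y' t * c t^2 = l * (y t * (1 + y t) * (1 - 8 * y t))"
    and W: "\<And>t. t \<in> T \<Longrightarrow> ((\<lambda>t. t * p t * c' t) has_field_derivative W t) (at t)"
    and eq: "\<And>t. t \<in> T \<Longrightarrow> W t * c t + l * y' t * (2 + 8 * y t) = x' t * (2 + 8 * x t) * c t^2"
  shows "\<exists>e>0. \<forall>t. norm t < e \<or> (\<exists>r::real. r > 0 \<and> t = complex_of_real r) \<longrightarrow>
      norm (x t) < 1/8 \<and> norm (y t) < 1/8 \<and> franel_gf (x t) = c t * franel_gf (y t)"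
proof -
  have cont: "continuous_on T x" "continuous_on T y"
    by (intro continuous_at_imp_continuous_on ballI DERIV_isCont[OF x] DERIV_isCont[OF y]; assumption)+
  obtain S where S: "open S" "connected S" "S \<subseteq> T"
    and posS: "\<And>r::real. r \<ge> 0 \<Longrightarrow> of_real r \<in> S"
    and small: "\<And>t. t \<in> S \<Longrightarrow> norm (x t) < 1/8" "\<And>t. t \<in> S \<Longrightarrow> norm (y t) < 1/8"
    using connected_domain_obtain[OF T cont pos] by metis
  have "0 \<in> S"
    using posS[of 0] by simp
  then obtain e where e: "e > 0" "ball 0 e \<subseteq> S"
    using S(1) open_contains_ball by blast
  have p_eq: "z * (1 + z) * (1 - 8 * z) = z - 7 * z^2 - 8 * z^3" for z :: complex
    by (simp add: algebra_simps power2_eq_square power3_eq_cube)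
  note px' = px [unfolded p_eq] and py' = py [unfolded p_eq]
  have main: "franel_gf (x t) = c t * franel_gf (y t)" if "t \<in> S" for t
  proof (rule franel_gf_transformation_connected[where S = S and x = x and y = y and c = c
        and x' = x' and y' = y' and c' = c' and p = p and W = W and l = l])
    show "p holomorphic_on S"
      using p(1) S(3) by (rule holomorphic_on_subset)
  qed (use S small x y c c0 init p(2) px' py' W eq that \<open>0 \<in> S\<close> in blast)+
  have in_S: "t \<in> S" if "norm t < e \<or> (\<exists>r::real. r > 0 \<and> t = of_real r)" for t
    using that e(2) posS by (auto simp: subset_iff)
  show ?thesis
    by (intro exI[of _ e] conjI allI impI e(1) small main in_S)
qed

section \<open>The quadratic and the cubic transformation\<close>

text \<open>Quotient rule with a prescribed result \<open>w / z\<close>: the cross-multiplied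
  condition is polynomial when the data are, hence within reach of \<open>algebra\<close>.\<close>

lemma DERIV_divide_eq:
  fixes f g :: "'a::real_normed_field \<Rightarrow> 'a"
  assumes "(f has_field_derivative f') (at t)" "(g has_field_derivative g') (at t)"
    and "g t \<noteq> 0" "z \<noteq> 0" and "(f' * g t - f t * g') * z = w * (g t)^2"
  shows "((\<lambda>t. f t / g t) has_field_derivative w / z) (at t)"
proof -
  have "(f' * g t - f t * g') / (g t * g t) = w / z"
    using assms(3-5) by (simp add: frac_eq_eq power2_eq_square)
  then show ?thesis
    using DERIV_divide[OF assms(1,2,3)] by simp
qed

lemmas derivative_simps = algebra_simps power2_eq_square power3_eq_cube power4_eq_xxxx

text \<open>\<open>p\<close> is solved from the first identity. With c' = 6 / v^2, \<open>W\<close>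
  is the derivative of t p c' = 27 t (t + 2) (t + 4) / (8 u^3 v), where 4 t + 21 = 3 v + u comes
  from the denominator. The factor 2 is the order of \<open>y\<close> at 0, as the lowest terms of
  the second identity show with p(0) = c(0) = 1.\<close>

lemma quadratic_identities:
  fixes t u v :: "'a::field_char_0"
  assumes nz: "u \<noteq> 0" "v \<noteq> 0" and uv: "u = t + 3" "v = t + 6"
  defines "x \<equiv> t * v / (8 * u^2)"
  and "y \<equiv> t^2 / (8 * u * v)"
  and "c \<equiv> 2 * (u / v)"
  and "p \<equiv> 9 * (t + 2) * (t + 4) * v / (16 * u^3)"
  and "x' \<equiv> 9 / (4 * u^3)" and "y' \<equiv> 9 * t * (t + 4) / (8 * (u^2 * v^2))"
  and "W \<equiv> 27 * ((3 * t^2 + 12 * t + 8) * u * v - t * (t + 2) * (t + 4) * (4 * t + 21))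
      / (8 * (u^4 * v^2))"
  shows "t * p * x' = x * (1 + x) * (1 - 8 * x)"
    "t * p * y' * c^2 = 2 * (y * (1 + y) * (1 - 8 * y))"
    "W * c + 2 * y' * (2 + 8 * y) = x' * (2 + 8 * x) * c^2"
proof -
  have x: "1 + x = 9 * (t + 2) * (t + 4) / (8 * u^2)" "1 - 8 * x = 9 / u^2"
     "2 + 8 * x = (2 * u^2 + t * v) / u^2"
    using nz by (simp_all add: x_def divide_simps) (simp_all add: uv; algebra)+
  have y: "1 + y = 9 * (t + 4)^2 / (8 * u * v)" "1 - 8 * y = 9 * (t + 2) / (u * v)"
     "2 + 8 * y = (2 * u * v + t^2) / (u * v)"
    using nz by (simp_all add: y_def divide_simps) (simp_all add: uv; algebra)+
  show "t * p * x' = x * (1 + x) * (1 - 8 * x)"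
    unfolding x unfolding x_def p_def x'_def
    using nz by (simp add: divide_simps power_mult_distrib)
  show "t * p * y' * c^2 = 2 * (y * (1 + y) * (1 - 8 * y))"
    unfolding y unfolding y_def p_def y'_def c_def
    using nz by (simp add: divide_simps power_mult_distrib) algebra
  \<comment> \<open>The first two identities are cancellations with \<open>u\<close> and
    \<open>v\<close> treated as free; this one is a genuine sum and needs their values in
    \<open>t\<close>.\<close>
  show "W * c + 2 * y' * (2 + 8 * y) = x' * (2 + 8 * x) * c^2"
    unfolding x y unfolding W_def y'_def c_def x'_def using nz
    by (simp add: divide_simps power_mult_distrib) (simp only: uv, algebra)
qed

lemma quadratic_deriv:
  fixes t :: complex
  assumes nz: "t + 3 \<noteq> 0" "t + 6 \<noteq> 0"
  shows "((\<lambda>t. t * (t + 6) / (8 * (t + 3)^2)) has_field_derivative 9 / (4 * (t + 3)^3)) (at t)"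
    "((\<lambda>t. t^2 / (8 * (t + 3) * (t + 6))) has_field_derivative
      9 * t * (t + 4) / (8 * ((t + 3)^2 * (t + 6)^2))) (at t)"
    "((\<lambda>t. 2 * ((t + 3) / (t + 6))) has_field_derivative 6 / (t + 6)^2) (at t)"
    "((\<lambda>t. t * (9 * (t + 2) * (t + 4) * (t + 6) / (16 * (t + 3)^3)) * (6 / (t + 6)^2)) has_field_derivative
      27 * ((3 * t^2 + 12 * t + 8) * (t + 3) * (t + 6) - t * (t + 2) * (t + 4) * (4 * t + 21))
      / (8 * ((t + 3)^4 * (t + 6)^2))) (at t)"
proof -
  show "((\<lambda>t. t * (t + 6) / (8 * (t + 3)^2)) has_field_derivative 9 / (4 * (t + 3)^3)) (at t)"
    by (rule DERIV_divide_eq[where f' = "2 * t + 6" and g' = "16 * (t + 3)"])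
      (((rule derivative_eq_intros refl)+, simp add: derivative_simps)+,
        simp add: nz del: distrib_left_numeral, simp add: nz del: distrib_left_numeral, algebra)
  show "((\<lambda>t. t^2 / (8 * (t + 3) * (t + 6))) has_field_derivative
      9 * t * (t + 4) / (8 * ((t + 3)^2 * (t + 6)^2))) (at t)"
    by (rule DERIV_divide_eq[where f' = "2 * t" and g' = "8 * (t + 6) + 8 * (t + 3)"])
      (((rule derivative_eq_intros refl)+, simp add: derivative_simps)+,
        simp add: nz del: distrib_left_numeral, simp add: nz del: distrib_left_numeral, algebra)
  have "((\<lambda>t. (2 * t + 6) / (t + 6)) has_field_derivative 6 / (t + 6)^2) (at t)"
    by (rule DERIV_divide_eq[where f' = "2" and g' = "1"])
      (((rule derivative_eq_intros refl)+, simp add: derivative_simps)+,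
        simp add: nz del: distrib_left_numeral, simp add: nz del: distrib_left_numeral, algebra)
  then show "((\<lambda>t. 2 * ((t + 3) / (t + 6))) has_field_derivative 6 / (t + 6)^2) (at t)"
    by (simp add: distrib_left)
  \<comment> \<open>The product t p c' is merged into one fraction, so that the quotient rule is
    applied once.\<close>
  have "((\<lambda>t. (54 * (t * (t + 2) * (t + 4) * (t + 6))) / (16 * ((t + 3)^3 * (t + 6)^2))) has_field_derivative
      27 * ((3 * t^2 + 12 * t + 8) * (t + 3) * (t + 6) - t * (t + 2) * (t + 4) * (4 * t + 21))
      / (8 * ((t + 3)^4 * (t + 6)^2))) (at t)"
    by (rule DERIV_divide_eq[where f' = "54 * (4 * t^3 + 36 * t^2 + 88 * t + 48)" and
          g' = "16 * (3 * (t + 3)^2 * (t + 6)^2 + (t + 3)^3 * (2 * (t + 6)))"])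
      (((rule derivative_eq_intros refl)+, simp add: derivative_simps)+,
        simp add: nz del: distrib_left_numeral, simp add: nz del: distrib_left_numeral, algebra)
  also have "(\<lambda>t::complex. 54 * (t * (t + 2) * (t + 4) * (t + 6)) / (16 * ((t + 3)^3 * (t + 6)^2)))
      = (\<lambda>t. t * (9 * (t + 2) * (t + 4) * (t + 6) / (16 * (t + 3)^3)) * (6 / (t + 6)^2))"
    by (simp add: mult_ac del: distrib_left_numeral distrib_right_numeral)
  finally show "((\<lambda>t. t * (9 * (t + 2) * (t + 4) * (t + 6) / (16 * (t + 3)^3)) * (6 / (t + 6)^2)) has_field_derivative
      27 * ((3 * t^2 + 12 * t + 8) * (t + 3) * (t + 6) - t * (t + 2) * (t + 4) * (4 * t + 21))
      / (8 * ((t + 3)^4 * (t + 6)^2))) (at t)" .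
qed

text \<open>With s = t + 2 one has u q = s^3 + 1 and t (t^2 + 6 t + 12) = s^3 - 8, so x = (s^3 - 8)
  / (8 (s^3 + 1)), which explains the factorizations of 1 + x and 1 - 8x. The two summands of
  \<open>W\<close> are (t p)' c' and t p c'', with c' = 9 (t + 1) / u^3. The factor 3 is again the
  order of \<open>y\<close> at 0.\<close>

lemma cubic_identities:
  fixes t u q :: "'a::field_char_0"
  assumes nz: "u \<noteq> 0" "q \<noteq> 0" and uq: "u = t + 3" "q = t^2 + 3 * t + 3"
  defines "x \<equiv> t * (t^2 + 6 * t + 12) / (8 * u * q)"
  and "y \<equiv> t^3 / (8 * u^3)"
  and "c \<equiv> 3 * (q / u^2)"
  and "p \<equiv> 3 * (t + 2) * (t^2 + 6 * t + 12) / (8 * u * q)"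
  and "x' \<equiv> 27 * (t + 2)^2 / (8 * u^2 * q^2)" and "y' \<equiv> 9 * t^2 / (8 * u^4)"
  and "W \<equiv> 27 * (((t + 2)^6 + 20 * (t + 2)^3 - 8) * (t + 1)
         - 2 * t^2 * (t^2 + 6 * t + 12) * (t + 2) * q) / (8 * u^5 * q^2)"
  shows "t * p * x' = x * (1 + x) * (1 - 8 * x)"
    "t * p * y' * c^2 = 3 * (y * (1 + y) * (1 - 8 * y))"
    "W * c + 3 * y' * (2 + 8 * y) = x' * (2 + 8 * x) * c^2"
proof -
  have x: "1 + x = 9 * (t + 2)^3 / (8 * u * q)" "1 - 8 * x = 9 / (u * q)"
     "2 + 8 * x = (2 * u * q + t * (t^2 + 6 * t + 12)) / (u * q)"
    using nz by (simp_all add: x_def divide_simps) (simp_all add: uq; algebra)+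
  have y: "1 + y = 9 * (t + 2) * (t^2 + 6 * t + 12) / (8 * u^3)" "1 - 8 * y = 9 * q / u^3"
     "2 + 8 * y = (2 * u^3 + t^3) / u^3"
    using nz by (simp_all add: y_def divide_simps) (simp_all only: uq, algebra+)
  show "t * p * x' = x * (1 + x) * (1 - 8 * x)"
    unfolding x unfolding x_def p_def x'_def
    using nz by (simp add: divide_simps power_mult_distrib) algebra
  show "t * p * y' * c^2 = 3 * (y * (1 + y) * (1 - 8 * y))"
    unfolding y unfolding y_def p_def y'_def c_def
    using nz by (simp add: divide_simps power_mult_distrib) algebra
  show "W * c + 3 * y' * (2 + 8 * y) = x' * (2 + 8 * x) * c^2"
    unfolding x y unfolding W_def y'_def c_def x'_def using nz
    by (simp add: divide_simps power_mult_distrib) (simp only: uq, algebra)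
qed

lemma cubic_deriv:
  fixes t :: complex
  assumes nz: "t + 3 \<noteq> 0" "t^2 + 3 * t + 3 \<noteq> 0"
  shows "((\<lambda>t. t * (t^2 + 6 * t + 12) / (8 * (t + 3) * (t^2 + 3 * t + 3))) has_field_derivative
      27 * (t + 2)^2 / (8 * (t + 3)^2 * (t^2 + 3 * t + 3)^2)) (at t)"
    "((\<lambda>t. t^3 / (8 * (t + 3)^3)) has_field_derivative 9 * t^2 / (8 * (t + 3)^4)) (at t)"
    "((\<lambda>t. 3 * ((t^2 + 3 * t + 3) / (t + 3)^2)) has_field_derivative 9 * (t + 1) / (t + 3)^3) (at t)"
    "((\<lambda>t. t * (3 * (t + 2) * (t^2 + 6 * t + 12) / (8 * (t + 3) * (t^2 + 3 * t + 3)))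
       * (9 * (t + 1) / (t + 3)^3)) has_field_derivative
      27 * (((t + 2)^6 + 20 * (t + 2)^3 - 8) * (t + 1)
         - 2 * t^2 * (t^2 + 6 * t + 12) * (t + 2) * (t^2 + 3 * t + 3))
      / (8 * (t + 3)^5 * (t^2 + 3 * t + 3)^2)) (at t)"
proof -
  show "((\<lambda>t. t * (t^2 + 6 * t + 12) / (8 * (t + 3) * (t^2 + 3 * t + 3))) has_field_derivative
      27 * (t + 2)^2 / (8 * (t + 3)^2 * (t^2 + 3 * t + 3)^2)) (at t)"
    by (rule DERIV_divide_eq[where f' = "3 * t^2 + 12 * t + 12" and
          g' = "8 * (t^2 + 3 * t + 3) + 8 * (t + 3) * (2 * t + 3)"])
      (((rule derivative_eq_intros refl)+, simp add: derivative_simps)+,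
        simp add: nz del: distrib_left_numeral, simp add: nz del: distrib_left_numeral, algebra)
  show "((\<lambda>t. t^3 / (8 * (t + 3)^3)) has_field_derivative 9 * t^2 / (8 * (t + 3)^4)) (at t)"
    by (rule DERIV_divide_eq[where f' = "3 * t^2" and g' = "24 * (t + 3)^2"])
      (((rule derivative_eq_intros refl)+, simp add: derivative_simps)+,
        simp add: nz del: distrib_left_numeral, simp add: nz del: distrib_left_numeral, algebra)
  have "((\<lambda>t. (3 * (t^2 + 3 * t + 3)) / (t + 3)^2) has_field_derivative 9 * (t + 1) / (t + 3)^3) (at t)"
    by (rule DERIV_divide_eq[where f' = "6 * t + 9" and g' = "2 * (t + 3)"])
      (((rule derivative_eq_intros refl)+, simp add: derivative_simps)+,
        simp add: nz del: distrib_left_numeral, simp add: nz del: distrib_left_numeral, algebra)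
  then show "((\<lambda>t. 3 * ((t^2 + 3 * t + 3) / (t + 3)^2)) has_field_derivative 9 * (t + 1) / (t + 3)^3) (at t)"
    by simp
  have "((\<lambda>t. (27 * (t * (t + 1) * (t + 2) * (t^2 + 6 * t + 12))) / (8 * ((t + 3)^4 * (t^2 + 3 * t + 3)))) has_field_derivative
      27 * (((t + 2)^6 + 20 * (t + 2)^3 - 8) * (t + 1)
         - 2 * t^2 * (t^2 + 6 * t + 12) * (t + 2) * (t^2 + 3 * t + 3))
      / (8 * (t + 3)^5 * (t^2 + 3 * t + 3)^2)) (at t)"
    by (rule DERIV_divide_eq[where f' = "27 * ((t + 1) * (t + 2) * (t^2 + 6 * t + 12)
            + t * (t + 2) * (t^2 + 6 * t + 12) + t * (t + 1) * (t^2 + 6 * t + 12)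
            + t * (t + 1) * (t + 2) * (2 * t + 6))" and
          g' = "8 * (4 * (t + 3)^3 * (t^2 + 3 * t + 3) + (t + 3)^4 * (2 * t + 3))"])
      (((rule derivative_eq_intros refl)+, simp add: derivative_simps)+,
        simp add: nz del: distrib_left_numeral, simp add: nz del: distrib_left_numeral, algebra)
  also have "(\<lambda>t::complex. 27 * (t * (t + 1) * (t + 2) * (t^2 + 6 * t + 12)) / (8 * ((t + 3)^4 * (t^2 + 3 * t + 3))))
      = (\<lambda>t. t * (3 * (t + 2) * (t^2 + 6 * t + 12) / (8 * (t + 3) * (t^2 + 3 * t + 3)))
            * (9 * (t + 1) / (t + 3)^3))"
    by (simp add: mult_ac power4_eq_xxxx power3_eq_cube del: distrib_left_numeral distrib_right_numeral)
  finally show "((\<lambda>t. t * (3 * (t + 2) * (t^2 + 6 * t + 12) / (8 * (t + 3) * (t^2 + 3 * t + 3)))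
       * (9 * (t + 1) / (t + 3)^3)) has_field_derivative
      27 * (((t + 2)^6 + 20 * (t + 2)^3 - 8) * (t + 1)
         - 2 * t^2 * (t^2 + 6 * t + 12) * (t + 2) * (t^2 + 3 * t + 3))
      / (8 * (t + 3)^5 * (t^2 + 3 * t + 3)^2)) (at t)" .
qed

text \<open>On the half-line both arguments have the shape a / (8 b), so staying in the disk amounts
  to the real inequality a < b.\<close>

lemma norm_of_real_divide_less:
  fixes a b :: real
  assumes "0 \<le> a" "a < b"
  shows "norm (complex_of_real a / (8 * of_real b)) < 1/8"
  using assms by (simp add: norm_divide norm_mult)

text \<open>\<open>T\<close> omits the poles of \<open>x\<close>, \<open>y\<close> and
  \<open>c\<close>; the only zero of \<open>c\<close>, at -3, is thereby omitted too.\<close>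

lemma franel_gf_quadratic:
  "\<exists>e>0. \<forall>t. norm t < e \<or> (\<exists>r::real. r > 0 \<and> t = complex_of_real r) \<longrightarrow>
      norm (t * (t + 6) / (8 * (t + 3)^2)) < 1/8 \<and>
      norm (t^2 / (8 * (t + 3) * (t + 6))) < 1/8 \<and>
      franel_gf (t * (t + 6) / (8 * (t + 3)^2))
        = 2 * ((t + 3) / (t + 6)) * franel_gf (t^2 / (8 * (t + 3) * (t + 6)))"
proof (rule franel_gf_transformation[where
      T = "{t. t + 3 \<noteq> 0 \<and> t + 6 \<noteq> 0}" and
      x = "\<lambda>t. t * (t + 6) / (8 * (t + 3)^2)" and
      y = "\<lambda>t. t^2 / (8 * (t + 3) * (t + 6))" and
      c = "\<lambda>t. 2 * ((t + 3) / (t + 6))" and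
      x' = "\<lambda>t. 9 / (4 * (t + 3)^3)" and
      y' = "\<lambda>t. 9 * t * (t + 4) / (8 * ((t + 3)^2 * (t + 6)^2))" and
      c' = "\<lambda>t. 6 / (t + 6)^2" and
      p = "\<lambda>t. 9 * (t + 2) * (t + 4) * (t + 6) / (16 * (t + 3)^3)" and
      W = "\<lambda>t. 27 * ((3 * t^2 + 12 * t + 8) * (t + 3) * (t + 6)
             - t * (t + 2) * (t + 4) * (4 * t + 21)) / (8 * ((t + 3)^4 * (t + 6)^2))" and
      l = 2])
  show "open {t::complex. t + 3 \<noteq> 0 \<and> t + 6 \<noteq> 0}"
    by (intro open_Collect_conj open_Collect_neq continuous_intros)
  show "(\<lambda>t::complex. 9 * (t + 2) * (t + 4) * (t + 6) / (16 * (t + 3)^3))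
      holomorphic_on {t. t + 3 \<noteq> 0 \<and> t + 6 \<noteq> 0}"
    by (intro holomorphic_intros) auto
next
  fix r :: real
  assume r: "r \<ge> 0"
  then have "complex_of_real (r + 3) \<noteq> 0" "complex_of_real (r + 6) \<noteq> 0"
    by (simp_all only: of_real_eq_0_iff)
  then show "complex_of_real r \<in> {t. t + 3 \<noteq> 0 \<and> t + 6 \<noteq> 0}"
    by simp
  \<comment> \<open>The differences of the two sides are 9 and 9 r + 18.\<close>
  have "r * (r + 6) < (r + 3)^2" "r^2 < (r + 3) * (r + 6)"
    using r by (simp_all add: power2_eq_square algebra_simps add_nonneg_pos)
  then show "norm (complex_of_real r * (of_real r + 6) / (8 * (of_real r + 3)^2)) < 1/8"
    "norm (complex_of_real r ^ 2 / (8 * (of_real r + 3) * (of_real r + 6))) < 1/8"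
    using r norm_of_real_divide_less[of "r * (r + 6)" "(r + 3)^2"]
      norm_of_real_divide_less[of "r^2" "(r + 3) * (r + 6)"]
    by (simp_all add: mult.assoc del: distrib_left_numeral)
qed (((simp only: mem_Collect_eq, elim conjE,
        rule quadratic_deriv quadratic_identities; (assumption | rule refl))
      | (simp del: distrib_left_numeral; fail))+)

lemma franel_gf_cubic:
  "\<exists>e>0. \<forall>t. norm t < e \<or> (\<exists>r::real. r > 0 \<and> t = complex_of_real r) \<longrightarrow>
      norm (t * (t^2 + 6 * t + 12) / (8 * (t + 3) * (t^2 + 3 * t + 3))) < 1/8 \<and>
      norm (t^3 / (8 * (t + 3)^3)) < 1/8 \<and>
      franel_gf (t * (t^2 + 6 * t + 12) / (8 * (t + 3) * (t^2 + 3 * t + 3)))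
        = 3 * ((t^2 + 3 * t + 3) / (t + 3)^2) * franel_gf (t^3 / (8 * (t + 3)^3))"
proof (rule franel_gf_transformation[where
      T = "{t. t + 3 \<noteq> 0 \<and> t^2 + 3 * t + 3 \<noteq> 0}" and
      x = "\<lambda>t. t * (t^2 + 6 * t + 12) / (8 * (t + 3) * (t^2 + 3 * t + 3))" and
      y = "\<lambda>t. t^3 / (8 * (t + 3)^3)" and
      c = "\<lambda>t. 3 * ((t^2 + 3 * t + 3) / (t + 3)^2)" and
      x' = "\<lambda>t. 27 * (t + 2)^2 / (8 * (t + 3)^2 * (t^2 + 3 * t + 3)^2)" and
      y' = "\<lambda>t. 9 * t^2 / (8 * (t + 3)^4)" and
      c' = "\<lambda>t. 9 * (t + 1) / (t + 3)^3" and
      p = "\<lambda>t. 3 * (t + 2) * (t^2 + 6 * t + 12) / (8 * (t + 3) * (t^2 + 3 * t + 3))" and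
      W = "\<lambda>t. 27 * (((t + 2)^6 + 20 * (t + 2)^3 - 8) * (t + 1)
             - 2 * t^2 * (t^2 + 6 * t + 12) * (t + 2) * (t^2 + 3 * t + 3))
             / (8 * (t + 3)^5 * (t^2 + 3 * t + 3)^2)" and
      l = 3])
  show "open {t::complex. t + 3 \<noteq> 0 \<and> t^2 + 3 * t + 3 \<noteq> 0}"
    by (intro open_Collect_conj open_Collect_neq continuous_intros)
  show "(\<lambda>t::complex. 3 * (t + 2) * (t^2 + 6 * t + 12) / (8 * (t + 3) * (t^2 + 3 * t + 3)))
      holomorphic_on {t. t + 3 \<noteq> 0 \<and> t^2 + 3 * t + 3 \<noteq> 0}"
    by (intro holomorphic_intros) (auto simp del: distrib_left_numeral)
next
  fix r :: real
  assume r: "r \<ge> 0"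
  then have "r^2 + 3 * r + 3 > 0"
    by (simp add: add_nonneg_pos)
  then have pos: "(r + 3) * (r^2 + 3 * r + 3) > 0"
    using r by simp
  have "complex_of_real (r + 3) \<noteq> 0" "complex_of_real (r^2 + 3 * r + 3) \<noteq> 0"
    using pos by (simp_all only: of_real_eq_0_iff) auto
  then show "complex_of_real r \<in> {t. t + 3 \<noteq> 0 \<and> t^2 + 3 * t + 3 \<noteq> 0}"
    by simp
  \<comment> \<open>The first pair differs by exactly 9, since the two sides are s^3 - 8 and s^3 + 1
    with s = r + 2.\<close>
  have "r * (r^2 + 6 * r + 12) < (r + 3) * (r^2 + 3 * r + 3)" "r^3 < (r + 3)^3"
    using r by (simp_all add: power2_eq_square power_strict_mono algebra_simps)
  then show "norm (complex_of_real r * (of_real r ^ 2 + 6 * of_real r + 12)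
      / (8 * (of_real r + 3) * (of_real r ^ 2 + 3 * of_real r + 3))) < 1/8"
    "norm (complex_of_real r ^ 3 / (8 * (of_real r + 3)^3)) < 1/8"
    using r norm_of_real_divide_less[of "r * (r^2 + 6 * r + 12)" "(r + 3) * (r^2 + 3 * r + 3)"]
      norm_of_real_divide_less[of "r^3" "(r + 3)^3"]
    by (simp_all add: mult.assoc del: distrib_left_numeral)
qed (((simp only: mem_Collect_eq, elim conjE,
        rule cubic_deriv cubic_identities; (assumption | rule refl))
      | (simp del: distrib_left_numeral; fail))+)

theorem proposition8p4:
  shows "(\<forall>x::complex. norm x < 1/8 \<longrightarrow> summable (\<lambda>n. of_nat (franel n) * x ^ n)) \<and>
    (\<exists>\<epsilon>>0. \<forall>t::complex. norm t < \<epsilon> \<or> (\<exists>r::real. r > 0 \<and> t = complex_of_real r) \<longrightarrow>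
      norm (t * (t + 6) / (8 * (t + 3)^2)) < 1/8 \<and>
      norm (t^2 / (8 * (t + 3) * (t + 6))) < 1/8 \<and>
      franel_gf (t * (t + 6) / (8 * (t + 3)^2))
        = 2 * ((t + 3) / (t + 6)) * franel_gf (t^2 / (8 * (t + 3) * (t + 6))) \<and>
      norm (t * (t^2 + 6 * t + 12) / (8 * (t + 3) * (t^2 + 3 * t + 3))) < 1/8 \<and>
      norm (t^3 / (8 * (t + 3)^3)) < 1/8 \<and>
      franel_gf (t * (t^2 + 6 * t + 12) / (8 * (t + 3) * (t^2 + 3 * t + 3)))
        = 3 * ((t^2 + 3 * t + 3) / (t + 3)^2) * franel_gf (t^3 / (8 * (t + 3)^3)))"
proof -
  obtain e1 where e1: "e1 > 0"
    "\<forall>t. norm t < e1 \<or> (\<exists>r::real. r > 0 \<and> t = complex_of_real r) \<longrightarrow>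
      norm (t * (t + 6) / (8 * (t + 3)^2)) < 1/8 \<and>
      norm (t^2 / (8 * (t + 3) * (t + 6))) < 1/8 \<and>
      franel_gf (t * (t + 6) / (8 * (t + 3)^2))
        = 2 * ((t + 3) / (t + 6)) * franel_gf (t^2 / (8 * (t + 3) * (t + 6)))"
    using franel_gf_quadratic by blast
  obtain e2 where e2: "e2 > 0"
    "\<forall>t. norm t < e2 \<or> (\<exists>r::real. r > 0 \<and> t = complex_of_real r) \<longrightarrow>
      norm (t * (t^2 + 6 * t + 12) / (8 * (t + 3) * (t^2 + 3 * t + 3))) < 1/8 \<and>
      norm (t^3 / (8 * (t + 3)^3)) < 1/8 \<and>
      franel_gf (t * (t^2 + 6 * t + 12) / (8 * (t + 3) * (t^2 + 3 * t + 3)))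
        = 3 * ((t^2 + 3 * t + 3) / (t + 3)^2) * franel_gf (t^3 / (8 * (t + 3)^3))"
    using franel_gf_cubic by blast
  show ?thesis
  \<comment> \<open>The radius \<open>min e1 e2\<close> serves both identities; the half-line
    alternative does not depend on the radius.\<close>
  proof (intro conjI exI[of _ "min e1 e2"] allI impI, goal_cases)
    case (1 x)
    then show ?case
      by (rule summable_franel)
  next
    case 2
    then show ?case
      using e1(1) e2(1) by simp
  qed (use e1(2) e2(2) in force)+
qed

end
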